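(* Let $\mu>0$ and $\eta=\mu^2/4$. For $x,y\in\mathbb{R}$ and $t>0$ let $$u(x,y,t)=\frac{1}{\sqrt{4\pi t}}\,e^{-\frac{(y-x-\mu t)^2}{4t}}$$ be the transition density (the density at $y$) of the drifted Brownian motion $B^\mu(t)=B(t)+\mu t+x$ started at $x$. Then $u$ solves the Cauchy problem $$\mathscr{D}_t^{\frac12,\eta}u+\sqrt{\eta}\,u=a(x,y)\left(\frac{\partial u}{\partial x}+\sqrt{\eta}\,u\right)=-a(x,y)\left(\frac{\partial u}{\partial y}-\sqrt{\eta}\,u\right),\qquad t>0,\ x,y\in\mathbb{R},$$ with initial condition $$u(x,y,0)=\delta(x-y),$$ where $a(x,y)=\mathbf{1}_{(-\infty,y]}(x)-\mathbf{1}_{(y,\infty)}(x)$.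
   Context: $B$ is a Brownian motion on $\mathbb{R}$ starting at the origin with generator $\Delta=\frac{d^2}{dx^2}$ (so $B(t)$ is a centered Gaussian variable with variance $2t$). $\mathscr{D}_t^{\frac12}$ is the Riemann--Liouville derivative of order $\frac12$ in $t$, $\big(\mathscr{D}_t^{\frac12}f\big)(t)=\frac{1}{\sqrt{\pi}}\frac{d}{dt}\int_0^t f(s)(t-s)^{-\frac12}\,ds$, and for $\eta>0$ the tempered Riemann--Liouville type derivative is $$\mathscr{D}_t^{\frac12,\eta}f:=e^{-\eta t}\,\mathscr{D}_t^{\frac12}\big(e^{\eta t}f\big)-\sqrt{\eta}\,f .$$ The derivative acts on the variable $t$ with $x,y$ fixed. The initial condition is understood in the sense that, for each $x$, the measures $u(x,y,t)\,dy$ converge weakly to the Dirac mass at $x$ as $t\downarrow 0$. $\mathbf{1}_A$ denotes the indicator function of $A$. *)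

theory Defs
  imports "HOL-Probability.Probability"
begin

definition brownian_motion :: "'w measure \<Rightarrow> (real \<Rightarrow> 'w \<Rightarrow> real) \<Rightarrow> bool" where
  \<comment> \<open>Normalised to have generator $d^2/dx^2$ (not half of it): $B(t) - B(s)$ has variance $2(t-s)$.
      The values of \<open>B\<close> at negative times are irrelevant.\<close>
  "brownian_motion M B \<longleftrightarrow>
     prob_space M \<and>
     (\<forall>t\<ge>0. B t \<in> borel_measurable M) \<and>
     (AE \<omega> in M. B 0 \<omega> = 0) \<and>
     (\<forall>s t. 0 \<le> s \<and> s < t \<longrightarrow>
        distributed M lborel (\<lambda>\<omega>. B t \<omega> - B s \<omega>)
          (\<lambda>z. ennreal (normal_density 0 (sqrt (2 * (t - s))) z))) \<and>
     (\<forall>n (\<tau> :: nat \<Rightarrow> real). 0 \<le> \<tau> 0 \<and> (\<forall>i<n. \<tau> i \<le> \<tau> (Suc i)) \<longrightarrow>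
        prob_space.indep_vars M (\<lambda>_. borel) (\<lambda>i \<omega>. B (\<tau> (Suc i)) \<omega> - B (\<tau> i) \<omega>) {..<n}) \<and>
     (AE \<omega> in M. continuous_on {0..} (\<lambda>t. B t \<omega>))"

definition drift_density :: "real \<Rightarrow> real \<Rightarrow> real \<Rightarrow> real \<Rightarrow> real" where
  "drift_density \<mu> x y t = 1 / sqrt (4 * pi * t) * exp (- ((y - x - \<mu> * t)\<^sup>2 / (4 * t)))"

definition rl_half_kernel :: "(real \<Rightarrow> real) \<Rightarrow> real \<Rightarrow> real \<Rightarrow> real" where
  "rl_half_kernel f t s = f s * (t - s) powr (- 1 / 2)"

definition rl_half_integral :: "(real \<Rightarrow> real) \<Rightarrow> real \<Rightarrow> real" where
  "rl_half_integral f t = (LBINT s:{0<..<t}. rl_half_kernel f t s)"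

definition rl_half_deriv :: "(real \<Rightarrow> real) \<Rightarrow> real \<Rightarrow> real" where
  "rl_half_deriv f t = 1 / sqrt pi * deriv (rl_half_integral f) t"

text \<open>
  Both the Lebesgue integral and \<^const>\<open>deriv\<close> are total, so \<^const>\<open>rl_half_deriv\<close> is only
  meaningful together with the following condition.
\<close>

definition rl_half_differentiable :: "(real \<Rightarrow> real) \<Rightarrow> real \<Rightarrow> bool" where
  "rl_half_differentiable f t \<longleftrightarrow>
     (\<forall>\<^sub>F r in nhds t. set_integrable lborel {0<..<r} (rl_half_kernel f r)) \<and>
     rl_half_integral f field_differentiable (at t)"

definition tempered_half_deriv :: "real \<Rightarrow> (real \<Rightarrow> real) \<Rightarrow> real \<Rightarrow> real" where
  "tempered_half_deriv \<eta> f t =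
     exp (- \<eta> * t) * rl_half_deriv (\<lambda>s. exp (\<eta> * s) * f s) t - sqrt \<eta> * f t"

definition tempered_half_differentiable :: "real \<Rightarrow> (real \<Rightarrow> real) \<Rightarrow> real \<Rightarrow> bool" where
  "tempered_half_differentiable \<eta> f t \<longleftrightarrow> rl_half_differentiable (\<lambda>s. exp (\<eta> * s) * f s) t"

definition sign_coeff :: "real \<Rightarrow> real \<Rightarrow> real" where
  "sign_coeff x y = indicator {..y} x - indicator {y<..} x"

text \<open>
  Weak convergence of finite Borel measures along a filter; the library's \<^const>\<open>weak_conv_m\<close>
  only treats sequences of measures.
\<close>

definition weakly_tends_to :: "('i \<Rightarrow> real measure) \<Rightarrow> real measure \<Rightarrow> 'i filter \<Rightarrow> bool" where
  "weakly_tends_to N L F \<longleftrightarrow>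
     (\<forall>\<^sub>F i in F. finite_borel_measure (N i)) \<and> finite_borel_measure L \<and>
     (\<forall>f :: real \<Rightarrow> real. continuous_on UNIV f \<and> bounded (range f) \<longrightarrow>
        ((\<lambda>i. \<integral>z. f z \<partial>N i) \<longlongrightarrow> (\<integral>z. f z \<partial>L)) F)"

end

theory Submission
  imports Defs "HOL-Real_Asymp.Real_Asymp"
begin

text \<open>
  Completing the square, $e^{\eta s} u(x,y,s) = e^{\mu w/2} (4\pi s)^{-1/2} e^{-w^2/(4s)}$ with
  $w = y - x$, so tempering removes the drift. The substitution $s = t/(1+v^2)$ turns the Abel
  integral of the driftless kernel into a function of $c = w^2/(4t)$ alone, which is
  differentiated under the integral sign by a Gaussian integral; the result is
  $\mathscr{D}_t^{1/2,\eta} u + \sqrt\eta\, u = \frac{|w|}{2t} u$, whereas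
  $\partial_x u + \sqrt\eta\, u = \frac{w}{2t} u$. On the diagonal $w = 0$ the Abel integral is
  constant in $t$.
\<close>

section \<open>Differentiation under the integral sign\<close>

text \<open>The mean value inequality on the convex set \<open>S\<close> turns the bound on
  \<open>f'\<close> into the bound \<open>g\<close> on all difference quotients at \<open>c\<close>,
  so dominated convergence applies along every sequence tending to \<open>c\<close>.\<close>

lemma DERIV_integral_dominated:
  fixes f f' :: "real \<Rightarrow> 'a \<Rightarrow> real"
  assumes "open S" "convex S" "c \<in> S"
    and f_int: "\<And>x. x \<in> S \<Longrightarrow> integrable M (f x)"
    and f': "\<And>x v. x \<in> S \<Longrightarrow> v \<in> space M \<Longrightarrow> ((\<lambda>x. f x v) has_field_derivative f' x v) (at x)"
    and f'_meas: "f' c \<in> borel_measurable M"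
    and g: "integrable M g" "\<And>x v. x \<in> S \<Longrightarrow> v \<in> space M \<Longrightarrow> \<bar>f' x v\<bar> \<le> g v"
  shows "((\<lambda>x. \<integral>v. f x v \<partial>M) has_field_derivative (\<integral>v. f' c v \<partial>M)) (at c)"
  unfolding has_field_derivative_iff
proof -
  have "((\<lambda>y. (integral\<^sup>L M (f y) - integral\<^sup>L M (f c)) / (y - c)) \<longlongrightarrow> integral\<^sup>L M (f' c)) (at c within S)"
    unfolding tendsto_at_iff_sequentially comp_def
  proof (intro allI impI)
    fix X :: "nat \<Rightarrow> real"
    assume "\<forall>i. X i \<in> S - {c}" and X: "X \<longlonglongrightarrow> c"
    then have XS: "X i \<in> S" "X i \<noteq> c" for i by auto
    have "(\<lambda>i. \<integral>v. (f (X i) v - f c v) / (X i - c) \<partial>M) \<longlonglongrightarrow> integral\<^sup>L M (f' c)"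
    proof (rule integral_dominated_convergence[OF f'_meas _ g(1)])
      show "(\<lambda>v. (f (X i) v - f c v) / (X i - c)) \<in> borel_measurable M" for i
        using f_int[OF XS(1)[of i]] f_int[OF \<open>c \<in> S\<close>] by (auto intro!: borel_measurable_divide borel_measurable_diff)
      show "AE v in M. (\<lambda>i. (f (X i) v - f c v) / (X i - c)) \<longlonglongrightarrow> f' c v"
      proof (rule AE_I2)
        fix v assume "v \<in> space M"
        then have "((\<lambda>y. (f y v - f c v) / (y - c)) \<longlongrightarrow> f' c v) (at c)"
          using f'[OF \<open>c \<in> S\<close>] by (simp add: has_field_derivative_iff)
        then show "(\<lambda>i. (f (X i) v - f c v) / (X i - c)) \<longlonglongrightarrow> f' c v"
          using X XS unfolding tendsto_at_iff_sequentially comp_def by auto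
      qed
      show "AE v in M. norm ((f (X i) v - f c v) / (X i - c)) \<le> g v" for i
      proof (rule AE_I2)
        fix v assume v: "v \<in> space M"
        have "norm (f (X i) v - f c v) \<le> g v * norm (X i - c)"
          using \<open>c \<in> S\<close> XS v g(2)
          by (intro field_differentiable_bound[OF \<open>convex S\<close>, where f' = "\<lambda>x. f' x v"])
             (auto intro: has_field_derivative_at_within f')
        then show "norm ((f (X i) v - f c v) / (X i - c)) \<le> g v"
          using XS(2)[of i] by (simp add: divide_simps)
      qed
    qed
    moreover have "(\<integral>v. (f (X i) v - f c v) / (X i - c) \<partial>M) =
        (integral\<^sup>L M (f (X i)) - integral\<^sup>L M (f c)) / (X i - c)" for i
      using Bochner_Integration.integral_diff[OF f_int[OF XS(1)[of i]] f_int[OF \<open>c \<in> S\<close>]] by simp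
    ultimately show "(\<lambda>i. (integral\<^sup>L M (f (X i)) - integral\<^sup>L M (f c)) / (X i - c)) \<longlonglongrightarrow> integral\<^sup>L M (f' c)"
      by (simp only:)
  qed
  \<comment> \<open>Openness of \<open>S\<close> makes the limit within \<open>S\<close> a full
    limit at \<open>c\<close>.\<close>
  then show "((\<lambda>y. (integral\<^sup>L M (f y) - integral\<^sup>L M (f c)) / (y - c)) \<longlongrightarrow> integral\<^sup>L M (f' c)) (at c)"
    using at_within_open[OF \<open>c \<in> S\<close> \<open>open S\<close>] by simp
qed

section \<open>The reduced Abel integral and its derivative\<close>

text \<open>The reflected scaling \<open>- sqrt c * v\<close> carries the Gaussian moment on the
  right half-line to the left one.\<close>

lemma has_bochner_integral_gaussian_left_half:
  assumes "0 < (c::real)"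
  shows "has_bochner_integral lborel (\<lambda>v. indicator {..<0} v * exp (- c * v\<^sup>2)) (sqrt (pi / c) / 2)"
proof -
  have "has_bochner_integral lborel (\<lambda>v. indicator {0..} (0 + - sqrt c * v) *\<^sub>R exp (- (0 + - sqrt c * v)\<^sup>2))
      ((sqrt pi / 2) /\<^sub>R \<bar>- sqrt c\<bar>)"
    using assms gaussian_moment_0
    by (intro lborel_has_bochner_integral_real_affine_iff[THEN iffD1]) auto
  \<comment> \<open>The closed and the open half-line differ only at \<open>v = 0\<close>, a null
    set.\<close>
  moreover have "AE v in lborel. indicator {0..} (0 + - sqrt c * v) *\<^sub>R exp (- (0 + - sqrt c * v)\<^sup>2)
      = indicator {..<0} v * exp (- c * v\<^sup>2)"
    using AE_lborel_singleton[of "0::real"]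
    by (rule AE_mp, intro AE_I2)
      (use assms in \<open>auto simp: indicator_def power_mult_distrib zero_le_mult_iff mult_le_0_iff\<close>)
  ultimately show ?thesis
    using assms
    by (subst has_bochner_integral_cong_AE[symmetric]) (auto simp: real_sqrt_divide field_simps)
qed

text \<open>In closed form, \<open>abel_gauss c\<close> is $\pi\, \mathrm{erfc}(\sqrt c)$ for $c \ge 0$.\<close>

definition abel_gauss :: "real \<Rightarrow> real" where
  "abel_gauss c = (\<integral>v. indicator {..<0} v * (2 / (1 + v\<^sup>2) * exp (- c * (1 + v\<^sup>2))) \<partial>lborel)"

text \<open>The bound \<open>2 / (1 + v^2)\<close> does not depend on \<open>c\<close>. The case
  \<open>c = 0\<close> is included because it occurs on the diagonal \<open>x = y\<close>.\<close>

lemma integrable_abel_gauss: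
  assumes "0 \<le> c"
  shows "integrable lborel (\<lambda>v::real. indicator {..<0} v * (2 / (1 + v\<^sup>2) * exp (- c * (1 + v\<^sup>2))))"
proof (rule Bochner_Integration.integrable_bound)
  show "integrable lborel (\<lambda>v::real. 2 * inverse (1 + v\<^sup>2))"
    using integrable_inverse_1_plus_square by (simp add: set_integrable_def)
  show "AE v in lborel. norm (indicator {..<0} v * (2 / (1 + v\<^sup>2) * exp (- c * (1 + v\<^sup>2))))
      \<le> norm (2 * inverse (1 + v\<^sup>2))"
  proof (rule AE_I2)
    fix v :: real
    have "exp (- c * (1 + v\<^sup>2)) \<le> 1" using assms by simp
    then have "2 / (1 + v\<^sup>2) * exp (- c * (1 + v\<^sup>2)) \<le> 2 / (1 + v\<^sup>2) * 1"
      by (intro mult_left_mono) auto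
    then show "norm (indicator {..<0} v * (2 / (1 + v\<^sup>2) * exp (- c * (1 + v\<^sup>2))))
        \<le> norm (2 * inverse (1 + v\<^sup>2))"
      by (auto simp: indicator_def abs_mult divide_inverse)
  qed
qed simp

text \<open>Differentiating in \<open>c\<close> brings down a factor \<open>- (1 + v^2)\<close>,
  which cancels the denominator and leaves \<open>exp (- c)\<close> times a pure Gaussian.\<close>

lemma DERIV_abel_gauss:
  assumes "0 < c"
  shows "(abel_gauss has_field_derivative - sqrt (pi / c) * exp (- c)) (at c)"
proof -
  let ?f' = "\<lambda>c v::real. indicator {..<0} v * (- 2 * exp (- c * (1 + v\<^sup>2)))"
  have f'_eq: "?f' c v = - 2 * exp (- c) * (indicator {..<0} v * exp (- c * v\<^sup>2))" for c v
    by (simp add: algebra_simps exp_add[symmetric])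
  have f'_hbi: "has_bochner_integral lborel (?f' c) (- 2 * exp (- c) * (sqrt (pi / c) / 2))" if "0 < c" for c
    unfolding f'_eq using has_bochner_integral_gaussian_left_half[OF that]
    by (intro has_bochner_integral_mult_right) auto
  have "(abel_gauss has_field_derivative (\<integral>v. ?f' c v \<partial>lborel)) (at c)"
    unfolding abel_gauss_def
  \<comment> \<open>Staying above \<open>c/2\<close> keeps the parameter away from 0, and the
    integrand of the derivative at \<open>c/2\<close> dominates all the others.\<close>
  proof (rule DERIV_integral_dominated[where S = "{c/2<..}" and g = "\<lambda>v. - ?f' (c/2) v"])
    show "integrable lborel (\<lambda>v. - ?f' (c/2) v)"
      using assms by (intro Bochner_Integration.integrable_minus integrable.intros[OF f'_hbi]) simp
    show "integrable lborel (\<lambda>v. indicator {..<0} v * (2 / (1 + v\<^sup>2) * exp (- x * (1 + v\<^sup>2))))"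
      if "x \<in> {c/2<..}" for x
      using that assms by (intro integrable_abel_gauss) auto
    fix x v :: real
    assume x: "x \<in> {c/2<..}"
    have "((\<lambda>c. k * (2 / q * exp (- c * q))) has_field_derivative k * (- 2 * exp (- x * q))) (at x)"
      if "q \<noteq> 0" for k q :: real
      using that by (auto intro!: derivative_eq_intros)
    then show "((\<lambda>c. indicator {..<0} v * (2 / (1 + v\<^sup>2) * exp (- c * (1 + v\<^sup>2)))) has_field_derivative ?f' x v) (at x)"
      by (simp add: add_nonneg_eq_0_iff)
    show "\<bar>?f' x v\<bar> \<le> - ?f' (c/2) v"
      using mult_right_mono[of "c / 2" x "1 + v\<^sup>2"] x by (auto simp: indicator_def)
  qed (use assms in auto)
  then show ?thesis
    unfolding has_bochner_integral_integral_eq[OF f'_hbi[OF assms]] by (simp add: mult.commute)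
qed

section \<open>The Abel integral of the driftless heat kernel\<close>

text \<open>The substitution \<open>s = t / (1 + v\<^sup>2)\<close>, run over \<open>v < 0\<close> so that it is increasing.\<close>

lemma
  assumes "0 < t" "0 \<le> b"
  shows set_integrable_rl_half_kernel_heat:
      "set_integrable lborel {0<..<t} (rl_half_kernel (\<lambda>s. exp (- b / s) / sqrt s) t)"
    and rl_half_integral_heat:
      "rl_half_integral (\<lambda>s. exp (- b / s) / sqrt s) t = abel_gauss (b / t)"
proof -
  let ?f = "rl_half_kernel (\<lambda>s. exp (- b / s) / sqrt s) t"
  let ?g = "\<lambda>v::real. t / (1 + v\<^sup>2)" and ?g' = "\<lambda>v::real. - 2 * t * v / (1 + v\<^sup>2)\<^sup>2"
  have pos: "0 < 1 + v\<^sup>2" for v :: real by (simp add: add_pos_nonneg)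
  have nz: "1 + v\<^sup>2 \<noteq> 0" for v :: real using pos[of v] by simp
  have g_pos: "0 < ?g v" for v using assms pos[of v] by simp
  have g_less: "?g v < t" if "v < 0" for v
    using assms pos[of v] that by (simp add: field_simps)
  have fg: "?f (?g v) * ?g' v = 2 / (1 + v\<^sup>2) * exp (- (b / t) * (1 + v\<^sup>2))" if "v < 0" for v
  proof -
    have "t - ?g v = t * v\<^sup>2 / (1 + v\<^sup>2)"
      using nz[of v] by (simp add: field_simps)
    then have "(t - ?g v) powr (- 1 / 2) = 1 / sqrt (t * v\<^sup>2 / (1 + v\<^sup>2))"
      using powr_minus[of "t - ?g v" "1/2"] assms by (simp add: powr_half_sqrt inverse_eq_divide)
    \<comment> \<open>For \<open>v < 0\<close> the root of \<open>v^2\<close> is \<open>- v\<close>;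
      this sign later cancels that of the factor \<open>v\<close> in \<open>?g'\<close>.\<close>
    also have "\<dots> = sqrt (1 + v\<^sup>2) / (sqrt t * - v)"
      using that by (simp add: real_sqrt_divide real_sqrt_mult)
    finally have 1: "(t - ?g v) powr (- 1 / 2) = sqrt (1 + v\<^sup>2) / (sqrt t * - v)" .
    define q where "q = 1 + v\<^sup>2"
    have "0 < q" using pos[of v] by (simp add: q_def)
    then have sqrt_q: "sqrt q * (sqrt q * z) = q * z" for z
      by (simp flip: mult.assoc)
    have "exp (- b / (t / q)) / sqrt (t / q) * (sqrt q / (sqrt t * - v)) * (- 2 * t * v / q\<^sup>2) =
        2 / q * exp (- (b / t) * q)"
      using that assms \<open>0 < q\<close> by (simp add: real_sqrt_divide power2_eq_square sqrt_q)
    then show ?thesis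
      unfolding rl_half_kernel_def 1 q_def .
  qed
  \<comment> \<open>As \<open>v\<close> runs from minus infinity up to 0, \<open>?g\<close> runs
    from 0 up to \<open>t\<close>.\<close>
  have lim0: "(?g \<longlongrightarrow> 0) at_bot" by real_asymp
  have limt: "(?g \<longlongrightarrow> t) (at_left 0)"
    by (rule tendsto_eq_intros | simp)+
  have int: "set_integrable lborel (einterval (- \<infinity>) 0) (\<lambda>v. ?f (?g v) * ?g' v)"
    using integrable_abel_gauss[of "b / t"] assms fg
    unfolding set_integrable_def zero_ereal_def einterval_eq
    by (subst Bochner_Integration.integrable_cong[OF refl,
          where g = "\<lambda>v. indicator {..<0} v * (2 / (1 + v\<^sup>2) * exp (- (b / t) * (1 + v\<^sup>2)))"])
       (auto simp: indicator_def)
  have lims: "((ereal \<circ> ?g \<circ> real_of_ereal) \<longlongrightarrow> 0) (at_right (- \<infinity>))"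
    "((ereal \<circ> ?g \<circ> real_of_ereal) \<longlongrightarrow> ereal t) (at_left 0)"
    using lim0 limt by (simp_all add: ereal_tendsto_simps zero_ereal_def)
  have deriv: "DERIV ?g v :> ?g' v" for v
    using nz[of v] by (auto intro!: derivative_eq_intros simp: power2_eq_square mult_ac)
  have cont': "isCont ?g' v" for v
    using nz[of v] by (intro continuous_intros) auto
  have cont: "isCont ?f (?g v)" if "v < 0" for v
    unfolding rl_half_kernel_def using g_pos[of v] g_less[OF that]
    by (intro continuous_intros) auto
  have nonneg: "0 \<le> ?f (?g v)" for v
    using g_pos[of v] by (simp add: rl_half_kernel_def)
  have nonneg': "0 \<le> ?g' v" if "v \<le> 0" for v
    using that assms by (intro divide_nonneg_nonneg) (auto simp: mult_nonneg_nonpos)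
  \<comment> \<open>For nonnegative integrands the substitution rule also transfers integrability,
    from the transformed integrand back to the singular kernel, so both claims come from one
    application.\<close>
  note * = interval_integral_substitution_nonneg[where f = ?f and g = ?g and g' = ?g',
      OF _ deriv cont cont' nonneg nonneg' lims int]
  have subst: "set_integrable lborel (einterval 0 (ereal t)) ?f"
    "(LBINT s=0..ereal t. ?f s) = (LBINT v=- \<infinity>..0. ?f (?g v) * ?g' v)"
    by (rule *; simp)+
  show "set_integrable lborel {0<..<t} ?f"
    using subst(1) by (simp add: zero_ereal_def)
  have "rl_half_integral (\<lambda>s. exp (- b / s) / sqrt s) t = (LBINT s=0..ereal t. ?f s)"
    using assms by (simp add: rl_half_integral_def interval_lebesgue_integral_def zero_ereal_def)
  also have "\<dots> = (LBINT v:{..<0}. ?f (?g v) * ?g' v)"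
    unfolding subst(2) by (simp add: interval_lebesgue_integral_def zero_ereal_def)
  also have "\<dots> = (LBINT v:{..<0}. 2 / (1 + v\<^sup>2) * exp (- (b / t) * (1 + v\<^sup>2)))"
    by (intro set_lebesgue_integral_cong allI impI fg) auto
  also have "\<dots> = abel_gauss (b / t)"
    by (simp add: abel_gauss_def set_lebesgue_integral_def)
  finally show "rl_half_integral (\<lambda>s. exp (- b / s) / sqrt s) t = abel_gauss (b / t)" .
qed

text \<open>Chain rule with \<open>c = w^2 / (4 * t)\<close>. The derivative of
  \<open>abel_gauss\<close> is available only for \<open>c > 0\<close>, so \<open>w = 0\<close> is
  split off; there the function is constant and the claimed derivative is 0.\<close>

lemma DERIV_rl_half_integral_heat:
  assumes "0 < t"
  shows "(rl_half_integral (\<lambda>s. exp (- (w\<^sup>2 / 4) / s) / sqrt s) has_field_derivative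
      sqrt pi * \<bar>w\<bar> / (2 * t * sqrt t) * exp (- (w\<^sup>2 / 4) / t)) (at t)"
proof -
  have "((\<lambda>t. abel_gauss (w\<^sup>2 / 4 / t)) has_field_derivative
      sqrt pi * \<bar>w\<bar> / (2 * t * sqrt t) * exp (- (w\<^sup>2 / 4) / t)) (at t)"
  proof (cases "w = 0")
    case False
    have "((\<lambda>t. w\<^sup>2 / 4 / t) has_field_derivative - (w\<^sup>2 / 4) / t\<^sup>2) (at t)"
      using assms by (auto intro!: derivative_eq_intros simp: power2_eq_square)
    then have deriv: "((\<lambda>t. abel_gauss (w\<^sup>2 / 4 / t)) has_field_derivative
        - sqrt (pi / (w\<^sup>2 / 4 / t)) * exp (- (w\<^sup>2 / 4 / t)) * (- (w\<^sup>2 / 4) / t\<^sup>2)) (at t)"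
      using assms False by (intro DERIV_chain2[OF DERIV_abel_gauss]) auto
    \<comment> \<open>Writing \<open>w^2\<close> as a product of absolute values and one factor
      \<open>t\<close> as \<open>sqrt t * sqrt t\<close> makes the cancellation purely
      algebraic.\<close>
    have "sqrt (pi / (w\<^sup>2 / 4 / t)) * ((w\<^sup>2 / 4) / t\<^sup>2) =
        2 * sqrt pi * sqrt t / \<bar>w\<bar> * ((\<bar>w\<bar> * \<bar>w\<bar> / 4) / (t * (sqrt t * sqrt t)))"
      using assms by (simp add: real_sqrt_divide real_sqrt_mult power2_eq_square)
    also have "\<dots> = sqrt pi * \<bar>w\<bar> / (2 * t * sqrt t)"
      using assms False by (simp add: divide_simps)
    finally have "sqrt pi * \<bar>w\<bar> / (2 * t * sqrt t) * exp (- (w\<^sup>2 / 4) / t) =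
        sqrt (pi / (w\<^sup>2 / 4 / t)) * ((w\<^sup>2 / 4) / t\<^sup>2) * exp (- (w\<^sup>2 / 4) / t)"
      by (simp only:)
    with deriv show ?thesis
      by (elim DERIV_cong) simp
  qed simp
  \<comment> \<open>The closed form holds for positive times only; agreement near \<open>t\<close>
    suffices for the derivative.\<close>
  moreover have "\<forall>\<^sub>F r in nhds t. rl_half_integral (\<lambda>s. exp (- (w\<^sup>2 / 4) / s) / sqrt s) r = abel_gauss (w\<^sup>2 / 4 / r)"
  proof (rule eventually_mono)
    show "\<forall>\<^sub>F r in nhds t. 0 < r"
      using eventually_nhds_in_open[of "{0<..}" t] assms by simp
  qed (rule rl_half_integral_heat, simp_all)
  ultimately show ?thesis
    by (subst DERIV_cong_ev[OF refl _ refl])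
qed

section \<open>Tempered derivative of the drifted density\<close>

text \<open>The cross term of the square, \<open>\<mu> * (y - x) / 2\<close>, is independent of
  \<open>s\<close> and therefore leaves the Abel integral as a constant factor.\<close>

lemma exp_drift_density:
  assumes "0 < s"
  shows "exp (\<mu>\<^sup>2 / 4 * s) * drift_density \<mu> x y s =
    exp (\<mu> * (y - x) / 2) / sqrt (4 * pi) * (exp (- ((y - x)\<^sup>2 / 4) / s) / sqrt s)"
proof -
  have "\<mu>\<^sup>2 / 4 * s - (y - x - \<mu> * s)\<^sup>2 / (4 * s) = \<mu> * (y - x) / 2 + - ((y - x)\<^sup>2 / 4) / s"
    using assms by (simp add: field_simps power2_eq_square)
  then have "exp (\<mu>\<^sup>2 / 4 * s) * exp (- ((y - x - \<mu> * s)\<^sup>2 / (4 * s))) =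
      exp (\<mu> * (y - x) / 2) * exp (- ((y - x)\<^sup>2 / 4) / s)"
    by (simp only: exp_add[symmetric] diff_conv_add_uminus)
  then show ?thesis
    by (simp add: drift_density_def real_sqrt_mult)
qed

lemma rl_half_kernel_drift_density:
  assumes "0 < s"
  shows "rl_half_kernel (\<lambda>s. exp (\<mu>\<^sup>2 / 4 * s) * drift_density \<mu> x y s) t s =
    exp (\<mu> * (y - x) / 2) / sqrt (4 * pi) *
      rl_half_kernel (\<lambda>s. exp (- ((y - x)\<^sup>2 / 4) / s) / sqrt s) t s"
  unfolding rl_half_kernel_def exp_drift_density[OF assms] by simp

lemma set_integrable_rl_half_kernel_drift_density:
  assumes "0 < t"
  shows "set_integrable lborel {0<..<t}
    (rl_half_kernel (\<lambda>s. exp (\<mu>\<^sup>2 / 4 * s) * drift_density \<mu> x y s) t)"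
proof -
  have "set_integrable lborel {0<..<t} (\<lambda>s. exp (\<mu> * (y - x) / 2) / sqrt (4 * pi) *
      rl_half_kernel (\<lambda>s. exp (- ((y - x)\<^sup>2 / 4) / s) / sqrt s) t s)"
    using assms by (intro set_integrable_mult_right set_integrable_rl_half_kernel_heat) auto
  then show ?thesis
    by (subst set_integrable_cong[OF refl refl rl_half_kernel_drift_density]) auto
qed

text \<open>Only times \<open>s > 0\<close> enter the integral, so there is no condition on
  \<open>t\<close> and the identity can be rewritten inside the function that is
  differentiated.\<close>

lemma rl_half_integral_drift_density:
  "rl_half_integral (\<lambda>s. exp (\<mu>\<^sup>2 / 4 * s) * drift_density \<mu> x y s) t =
    exp (\<mu> * (y - x) / 2) / sqrt (4 * pi) *
      rl_half_integral (\<lambda>s. exp (- ((y - x)\<^sup>2 / 4) / s) / sqrt s) t"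
  unfolding rl_half_integral_def set_integral_mult_right[symmetric]
  by (intro set_lebesgue_integral_cong allI impI rl_half_kernel_drift_density) auto

lemma DERIV_rl_half_integral_drift_density:
  assumes "0 < t"
  shows "(rl_half_integral (\<lambda>s. exp (\<mu>\<^sup>2 / 4 * s) * drift_density \<mu> x y s) has_field_derivative
      sqrt pi * exp (\<mu>\<^sup>2 / 4 * t) * (\<bar>y - x\<bar> / (2 * t)) * drift_density \<mu> x y t) (at t)"
proof -
  have "sqrt pi * exp (\<mu>\<^sup>2 / 4 * t) * (\<bar>y - x\<bar> / (2 * t)) * drift_density \<mu> x y t =
      sqrt pi * (\<bar>y - x\<bar> / (2 * t)) * (exp (\<mu>\<^sup>2 / 4 * t) * drift_density \<mu> x y t)"
    by simp
  also have "\<dots> = exp (\<mu> * (y - x) / 2) / sqrt (4 * pi) *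
      (sqrt pi * \<bar>y - x\<bar> / (2 * t * sqrt t) * exp (- ((y - x)\<^sup>2 / 4) / t))"
    unfolding exp_drift_density[OF assms] by (simp add: mult_ac)
  finally show ?thesis
    unfolding rl_half_integral_drift_density
    using DERIV_cmult[OF DERIV_rl_half_integral_heat[OF assms, of "y - x"],
        of "exp (\<mu> * (y - x) / 2) / sqrt (4 * pi)"]
    by simp
qed

lemma tempered_half_differentiable_drift_density:
  assumes "0 < t"
  shows "tempered_half_differentiable (\<mu>\<^sup>2 / 4) (drift_density \<mu> x y) t"
  unfolding tempered_half_differentiable_def rl_half_differentiable_def
proof
  have "\<forall>\<^sub>F r in nhds t. 0 < r"
    using eventually_nhds_in_open[of "{0<..}" t] assms by simp
  then show "\<forall>\<^sub>F r in nhds t. set_integrable lborel {0<..<r}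
      (rl_half_kernel (\<lambda>s. exp (\<mu>\<^sup>2 / 4 * s) * drift_density \<mu> x y s) r)"
    by (rule eventually_mono) (rule set_integrable_rl_half_kernel_drift_density)
qed (use DERIV_rl_half_integral_drift_density[OF assms] in \<open>auto simp: field_differentiable_def\<close>)

text \<open>The prefactors \<open>exp (- \<eta> * t)\<close> and \<open>1 / sqrt pi\<close> cancel
  against the derivative of the Abel integral; for \<open>\<mu> \<ge> 0\<close> the root of
  \<open>\<mu>^2 / 4\<close> is \<open>\<mu> / 2\<close>.\<close>

lemma tempered_half_deriv_drift_density:
  assumes "0 < t" "0 \<le> \<mu>"
  shows "tempered_half_deriv (\<mu>\<^sup>2 / 4) (drift_density \<mu> x y) t =
    (\<bar>y - x\<bar> / (2 * t) - \<mu> / 2) * drift_density \<mu> x y t"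
  using assms DERIV_imp_deriv[OF DERIV_rl_half_integral_drift_density[OF assms(1), of \<mu> x y]]
  by (simp add: tempered_half_deriv_def rl_half_deriv_def real_sqrt_divide exp_minus field_simps)

section \<open>Space derivatives and the sign coefficient\<close>

lemma DERIV_drift_density_left:
  assumes "0 < t"
  shows "((\<lambda>\<xi>. drift_density \<mu> \<xi> y t) has_field_derivative
      ((y - x) / (2 * t) - \<mu> / 2) * drift_density \<mu> x y t) (at x)"
proof -
  have "((\<lambda>\<xi>. k * exp (- ((y - \<xi> - \<mu> * t)\<^sup>2 / (4 * t)))) has_field_derivative
      ((y - x) / (2 * t) - \<mu> / 2) * (k * exp (- ((y - x - \<mu> * t)\<^sup>2 / (4 * t))))) (at x)" for k
    using assms by (auto intro!: derivative_eq_intros simp: field_simps)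
  then show ?thesis
    unfolding drift_density_def .
qed

lemma DERIV_drift_density_right:
  assumes "0 < t"
  shows "((\<lambda>\<zeta>. drift_density \<mu> x \<zeta> t) has_field_derivative
      - ((y - x) / (2 * t) - \<mu> / 2) * drift_density \<mu> x y t) (at y)"
proof -
  have "((\<lambda>\<zeta>. k * exp (- ((\<zeta> - x - \<mu> * t)\<^sup>2 / (4 * t)))) has_field_derivative
      - ((y - x) / (2 * t) - \<mu> / 2) * (k * exp (- ((y - x - \<mu> * t)\<^sup>2 / (4 * t))))) (at y)" for k
    using assms by (auto intro!: derivative_eq_intros simp: field_simps)
  then show ?thesis
    unfolding drift_density_def .
qed

text \<open>This reconciles the absolute value produced by the time derivative with the signed
  factor from the space derivatives. On the diagonal the coefficient is 1, but \<open>y - x\<close>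
  vanishes.\<close>

lemma sign_coeff_mult: "sign_coeff x y * (y - x) = \<bar>y - x\<bar>"
  by (auto simp: sign_coeff_def indicator_def)

section \<open>Law of the drifted Brownian motion\<close>

lemma drift_density_eq_normal_density:
  assumes "0 < t"
  shows "drift_density \<mu> x y t = normal_density (x + \<mu> * t) (sqrt (2 * t)) y"
  using assms by (simp add: drift_density_def normal_density_def algebra_simps)

text \<open>The Gaussian law is given for increments, and \<open>B 0\<close> vanishes only almost
  surely. So \<open>B t\<close> is replaced by \<open>B t - B 0\<close>, which leaves the
  distribution unchanged, and an affine map of a normal variable finishes.\<close>

lemma distributed_drift_density:
  assumes "brownian_motion M B" "0 < t"
  shows "distributed M lborel (\<lambda>\<omega>. B t \<omega> + \<mu> * t + x) (\<lambda>y. ennreal (drift_density \<mu> x y t))"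
proof -
  interpret prob_space M using assms by (simp add: brownian_motion_def)
  have B_meas [measurable]: "B t \<in> borel_measurable M" "B 0 \<in> borel_measurable M"
    and B0: "AE \<omega> in M. B 0 \<omega> = 0"
    using assms by (auto simp: brownian_motion_def)
  have "distributed M lborel (\<lambda>\<omega>. B t \<omega> - B 0 \<omega>)
      (\<lambda>z. ennreal (normal_density 0 (sqrt (2 * (t - 0))) z))"
    using assms unfolding brownian_motion_def by blast
  then have *: "distributed M lborel (\<lambda>\<omega>. (x + \<mu> * t) + 1 * (B t \<omega> - B 0 \<omega>))
      (normal_density (x + \<mu> * t + 1 * 0) (\<bar>1\<bar> * sqrt (2 * t)))"
    using assms by (intro normal_density_affine) auto
  have "distr M lborel (\<lambda>\<omega>. B t \<omega> + \<mu> * t + x) =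
      distr M lborel (\<lambda>\<omega>. (x + \<mu> * t) + 1 * (B t \<omega> - B 0 \<omega>))"
    using B0 by (intro distr_cong_AE) (auto elim!: eventually_mono)
  with * show ?thesis
    using assms(2) by (simp add: distributed_def drift_density_eq_normal_density)
qed

section \<open>Weak convergence to the initial Dirac mass\<close>

text \<open>The substitution moves mean and deviation out of the density into the argument of
  \<open>f\<close>, so that limits can be taken against one fixed measure.\<close>

lemma integral_normal_density_affine:
  fixes f :: "real \<Rightarrow> real"
  assumes "0 < \<sigma>"
  shows "(\<integral>z. normal_density m \<sigma> z * f z \<partial>lborel) =
    (\<integral>z. std_normal_density z * f (m + \<sigma> * z) \<partial>lborel)"
proof -
  have "\<sigma> * normal_density m \<sigma> (m + \<sigma> * z) = std_normal_density z" for z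
    using assms by (simp add: normal_density_def real_sqrt_mult power_mult_distrib)
  then have density: "\<sigma> * (normal_density m \<sigma> (m + \<sigma> * z) * f (m + \<sigma> * z)) =
      std_normal_density z * f (m + \<sigma> * z)" for z
    by (metis mult.assoc)
  have "(\<integral>z. normal_density m \<sigma> z * f z \<partial>lborel) =
      \<sigma> * (\<integral>z. normal_density m \<sigma> (m + \<sigma> * z) * f (m + \<sigma> * z) \<partial>lborel)"
    using lborel_integral_real_affine[of \<sigma> "\<lambda>z. normal_density m \<sigma> z * f z" m] assms by simp
  also have "\<dots> = (\<integral>z. std_normal_density z * f (m + \<sigma> * z) \<partial>lborel)"
    unfolding density[symmetric] by (rule integral_mult_right_zero[symmetric])
  finally show ?thesis .
qed

text \<open>After standardisation the argument \<open>m t + \<sigma> t * z\<close> tends to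
  \<open>x\<close> for each \<open>z\<close>. Continuity of \<open>f\<close> gives pointwise
  convergence and boundedness gives the dominating function
  \<open>K * std_normal_density z\<close>.\<close>

lemma weakly_tends_to_normal_density:
  assumes m: "(m \<longlongrightarrow> x) (at_right 0)" and \<sigma>: "(\<sigma> \<longlongrightarrow> 0) (at_right (0::real))"
    and \<sigma>_pos: "\<And>t. 0 < t \<Longrightarrow> 0 < \<sigma> t"
  shows "weakly_tends_to (\<lambda>t. density lborel (normal_density (m t) (\<sigma> t))) (return borel x) (at_right 0)"
  unfolding weakly_tends_to_def
proof (intro conjI allI impI)
  have "finite_borel_measure (density lborel (normal_density (m t) (\<sigma> t)))" if "0 < t" for t
  proof -
    interpret prob_space "density lborel (normal_density (m t) (\<sigma> t))"
      using \<sigma>_pos[OF that] by (rule prob_space_normal_density)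
    show ?thesis by unfold_locales simp_all
  qed
  then show "\<forall>\<^sub>F t in at_right 0. finite_borel_measure (density lborel (normal_density (m t) (\<sigma> t)))"
    by (simp add: eventually_at_right_less eventually_mono[OF eventually_at_right_less])
  interpret ret: prob_space "return borel x" by (rule prob_space_return) simp
  show "finite_borel_measure (return borel x)" by unfold_locales simp_all
  fix f :: "real \<Rightarrow> real"
  assume f: "continuous_on UNIV f \<and> bounded (range f)"
  then obtain K where K: "\<And>z. \<bar>f z\<bar> \<le> K" by (auto simp: bounded_iff)
  have f_cont: "isCont f z" for z using f by (simp add: continuous_on_eq_continuous_at)
  have f_meas [measurable]: "f \<in> borel_measurable borel" using f by (intro borel_measurable_continuous_onI) auto
  have "((\<lambda>t. \<integral>z. std_normal_density z * f (m t + \<sigma> t * z) \<partial>lborel) \<longlongrightarrow> f x) (at_right 0)"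
    unfolding tendsto_at_iff_sequentially comp_def
  proof (intro allI impI)
    fix X :: "nat \<Rightarrow> real"
    assume "\<forall>i. X i \<in> {0<..} - {0}" and "X \<longlonglongrightarrow> 0"
    then have lim: "(\<lambda>i. m (X i)) \<longlonglongrightarrow> x" "(\<lambda>i. \<sigma> (X i)) \<longlonglongrightarrow> 0"
      using m \<sigma> unfolding tendsto_at_iff_sequentially comp_def by auto
    have "(\<lambda>i. \<integral>z. std_normal_density z * f (m (X i) + \<sigma> (X i) * z) \<partial>lborel)
        \<longlonglongrightarrow> (\<integral>z. std_normal_density z * f x \<partial>lborel)"
    proof (rule integral_dominated_convergence[where w = "\<lambda>z. K * std_normal_density z"])
      have "(\<lambda>i. m (X i) + \<sigma> (X i) * z) \<longlonglongrightarrow> x" for z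
        using tendsto_add[OF lim(1) tendsto_mult_left_zero[OF lim(2)]] by simp
      then show "AE z in lborel. (\<lambda>i. std_normal_density z * f (m (X i) + \<sigma> (X i) * z))
          \<longlonglongrightarrow> std_normal_density z * f x"
        by (intro AE_I2 tendsto_mult tendsto_const isCont_tendsto_compose[OF f_cont])
      show "AE z in lborel. norm (std_normal_density z * f (m (X i) + \<sigma> (X i) * z))
          \<le> K * std_normal_density z" for i
      proof (rule AE_I2)
        fix z
        show "norm (std_normal_density z * f (m (X i) + \<sigma> (X i) * z)) \<le> K * std_normal_density z"
          using mult_right_mono[OF K[of "m (X i) + \<sigma> (X i) * z"], of "std_normal_density z"]
          by (simp add: abs_mult mult.commute)
      qed
    qed (use f_meas in auto)
    then show "(\<lambda>i. \<integral>z. std_normal_density z * f (m (X i) + \<sigma> (X i) * z) \<partial>lborel) \<longlonglongrightarrow> f x"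
      by simp
  qed
  moreover have "\<forall>\<^sub>F t in at_right 0. (\<integral>z. std_normal_density z * f (m t + \<sigma> t * z) \<partial>lborel) =
      (\<integral>z. f z \<partial>density lborel (normal_density (m t) (\<sigma> t)))"
    using eventually_at_right_less[of 0]
    by eventually_elim (simp add: integral_density integral_normal_density_affine[OF \<sigma>_pos, symmetric])
  ultimately show "((\<lambda>t. \<integral>z. f z \<partial>density lborel (normal_density (m t) (\<sigma> t))) \<longlongrightarrow> (\<integral>z. f z \<partial>return borel x)) (at_right 0)"
    using Lim_transform_eventually by (subst integral_return) auto
qed

text \<open>Needed because \<open>drift_density\<close> is identified with a normal density only for
  \<open>t > 0\<close>, that is, eventually in \<open>at_right 0\<close>.\<close>

lemma weakly_tends_to_cong:
  assumes "\<forall>\<^sub>F i in F. N i = N' i"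
  shows "weakly_tends_to N L F \<longleftrightarrow> weakly_tends_to N' L F"
proof -
  have "(\<forall>\<^sub>F i in F. finite_borel_measure (N i)) \<longleftrightarrow> (\<forall>\<^sub>F i in F. finite_borel_measure (N' i))"
    by (rule eventually_cong[OF assms]) simp
  moreover have "((\<lambda>i. \<integral>z. f z \<partial>N i) \<longlongrightarrow> l) F \<longleftrightarrow> ((\<lambda>i. \<integral>z. f z \<partial>N' i) \<longlongrightarrow> l) F"
    for f :: "real \<Rightarrow> real" and l
    by (rule tendsto_cong) (use assms in \<open>auto elim: eventually_mono\<close>)
  ultimately show ?thesis by (simp add: weakly_tends_to_def)
qed

lemma weakly_tends_to_drift_density:
  "weakly_tends_to (\<lambda>t. density lborel (\<lambda>y. ennreal (drift_density \<mu> x y t)))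
     (return borel x) (at_right 0)"
proof -
  have "\<forall>\<^sub>F t in at_right 0. density lborel (\<lambda>y. ennreal (drift_density \<mu> x y t)) =
      density lborel (normal_density (x + \<mu> * t) (sqrt (2 * t)))"
    using eventually_at_right_less[of 0]
    by eventually_elim (simp add: drift_density_eq_normal_density)
  moreover have "((\<lambda>t. x + \<mu> * t) \<longlongrightarrow> x) (at_right 0)" "((\<lambda>t. sqrt (2 * t)) \<longlongrightarrow> 0) (at_right 0)"
    by (auto intro!: tendsto_eq_intros)
  ultimately show ?thesis
    using weakly_tends_to_normal_density by (subst weakly_tends_to_cong) auto
qed

section \<open>The Cauchy problem\<close>

theorem theorem1:
  fixes \<mu> \<eta> :: real
    and u :: "real \<Rightarrow> real \<Rightarrow> real \<Rightarrow> real"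
    and M :: "'w measure" and B :: "real \<Rightarrow> 'w \<Rightarrow> real"
  assumes "\<mu> > 0" and "\<eta> = \<mu>\<^sup>2 / 4"
    and "u = drift_density \<mu>"
  shows "(brownian_motion M B \<longrightarrow>
            (\<forall>x t. t > 0 \<longrightarrow>
               distributed M lborel (\<lambda>\<omega>. B t \<omega> + \<mu> * t + x) (\<lambda>y. ennreal (u x y t))))
       \<and> (\<forall>x y t. t > 0 \<longrightarrow>
            tempered_half_differentiable \<eta> (\<lambda>s. u x y s) t \<and>
            (\<lambda>\<xi>. u \<xi> y t) field_differentiable (at x) \<and>
            (\<lambda>\<zeta>. u x \<zeta> t) field_differentiable (at y) \<and>
            tempered_half_deriv \<eta> (\<lambda>s. u x y s) t + sqrt \<eta> * u x y t
              = sign_coeff x y * (deriv (\<lambda>\<xi>. u \<xi> y t) x + sqrt \<eta> * u x y t) \<and>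
            sign_coeff x y * (deriv (\<lambda>\<xi>. u \<xi> y t) x + sqrt \<eta> * u x y t)
              = - sign_coeff x y * (deriv (\<lambda>\<zeta>. u x \<zeta> t) y - sqrt \<eta> * u x y t))
       \<and> (\<forall>x. weakly_tends_to (\<lambda>t. density lborel (\<lambda>y. ennreal (u x y t)))
               (return borel x) (at_right 0))"
proof -
  \<comment> \<open>Positivity of \<open>\<mu>\<close> fixes the sign of the root.\<close>
  have sqrt_\<eta>: "sqrt \<eta> = \<mu> / 2"
    using assms(1) unfolding assms(2) by (simp add: real_sqrt_divide)
  show ?thesis
    unfolding assms(3)
  proof (intro conjI impI allI)
    fix x y t :: real
    assume t: "0 < t"
    let ?u = "drift_density \<mu>"
    note deriv_x = DERIV_drift_density_left[OF t, of \<mu> y x]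
    note deriv_y = DERIV_drift_density_right[OF t, of \<mu> x y]
    show "tempered_half_differentiable \<eta> (\<lambda>s. ?u x y s) t"
      unfolding assms(2) using t by (rule tempered_half_differentiable_drift_density)
    show "(\<lambda>\<xi>. ?u \<xi> y t) field_differentiable (at x)" "(\<lambda>\<zeta>. ?u x \<zeta> t) field_differentiable (at y)"
      using deriv_x deriv_y unfolding field_differentiable_def by blast+
    \<comment> \<open>Adding \<open>sqrt \<eta> * u\<close> cancels the term
      \<open>- \<mu> / 2\<close> in the tempered derivative; it does the same in the
      \<open>x\<close>-derivative below.\<close>
    have "tempered_half_deriv \<eta> (?u x y) t + sqrt \<eta> * ?u x y t = \<bar>y - x\<bar> / (2 * t) * ?u x y t"
      using tempered_half_deriv_drift_density[OF t, of \<mu> x y] assms(1) unfolding sqrt_\<eta>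
      by (simp add: assms(2) algebra_simps)
    also have "\<dots> = sign_coeff x y * (deriv (\<lambda>\<xi>. ?u \<xi> y t) x + sqrt \<eta> * ?u x y t)"
      unfolding DERIV_imp_deriv[OF deriv_x] sqrt_\<eta> sign_coeff_mult[symmetric]
      by (simp add: algebra_simps)
    finally show "tempered_half_deriv \<eta> (\<lambda>s. ?u x y s) t + sqrt \<eta> * ?u x y t
        = sign_coeff x y * (deriv (\<lambda>\<xi>. ?u \<xi> y t) x + sqrt \<eta> * ?u x y t)" .
    \<comment> \<open>The density depends on \<open>x\<close> and \<open>y\<close> through
      \<open>y - x\<close> only, so its two space derivatives are opposite.\<close>
    show "sign_coeff x y * (deriv (\<lambda>\<xi>. ?u \<xi> y t) x + sqrt \<eta> * ?u x y t)
        = - sign_coeff x y * (deriv (\<lambda>\<zeta>. ?u x \<zeta> t) y - sqrt \<eta> * ?u x y t)"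
      unfolding DERIV_imp_deriv[OF deriv_x] DERIV_imp_deriv[OF deriv_y] sqrt_\<eta>
      by (simp add: algebra_simps add_divide_distrib diff_divide_distrib)
  qed (auto intro: distributed_drift_density weakly_tends_to_drift_density)
qed

end
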